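(* Let $K$ be a positive integer and let $\lambda>0$ be such that $1/\lambda$ is an integer with $4\mid (1/\lambda)$ and $(1/\lambda)\mid K$. Let $f(x)=f_1x+f_2x^2 \pmod K$ be a quadratic permutation polynomial (QPP) over $\mathbb{Z}_K$ with a quadratic inverse $g(x)=g_1x+g_2x^2\pmod K$. Consider the binary 3-dimensional turbo code (3D-TC) of information length $K$ with permeability rate $\lambda$, regular puncturing pattern $\mathbf p=[1100\cdots00]$ of period $2/\lambda$, interleaver generated by $f$, tailbiting upper and lower constituent encoders with feedforward polynomial $1+D+D^3$ and feedback polynomial $1+D^2+D^3$, and any patch whose encoder maps the all-zero sequence to the all-zero sequence. Then: (i) if $2g_2\equiv 0\pmod K$, the minimum distance of this 3D-TC is at most $27$; (ii) if $4g_2\equiv 0\pmod K$, the minimum distance of this 3D-TC is at most $54$.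
   Context: QPPs. For an integer $M\ge 2$ and nonnegative integers $f_1,f_2$, the polynomial $f(x)=f_1x+f_2x^2\pmod M$ is a quadratic permutation polynomial (QPP) over $\mathbb{Z}_M$ if it permutes $\{0,1,\dots,M-1\}$. It has a quadratic inverse $g$ if the inverse permutation is also generated by a QPP $g(x)=g_1x+g_2x^2\pmod M$. Tailbiting constituent code. Sequences of length $K$ over $\mathbb{F}_2$ are indexed by $\mathbb{Z}_K=\{0,\dots,K-1\}$. With tailbiting termination (initial trellis state equals final trellis state) and generator $(1+D+D^3)/(1+D^2+D^3)$, a pair (input $\mathbf v$, parity output $\mathbf y$) of length-$K$ binary sequences is valid if there is a binary sequence $(s_t)_{t\in\mathbb{Z}_K}$ with $v_t=s_t+s_{t-2}+s_{t-3}$ and $y_t=s_t+s_{t-1}+s_{t-3}$ over $\mathbb{F}_2$ for all $t$, indices modulo $K$. 3D-TC. The information sequence is $\mathbf u\in\mathbb{F}_2^K$. The interleaved sequence $\mathbf u'$ is given by $u'_{f(i)}=u_i$ for $i\in\mathbb{Z}_K$. The upper parity sequence $\mathbf x_a$ and the lower parity sequence $\mathbf x_b$ are such that $(\mathbf u,\mathbf x_a)$ and $(\mathbf u',\mathbf x_b)$ are valid pairs. Form the alternating sequence $\mathbf x^{\mathrm{TC}}=(x_{a,0},x_{b,0},x_{a,1},x_{b,1},\dots)$. The regular puncturing pattern $\mathbf p=[1100\cdots00]$ of period $2/\lambda$, applied periodically to $\mathbf x^{\mathrm{TC}}$, selects the bits $x_{a,i},x_{b,i}$ with $i\equiv 0\pmod{1/\lambda}$.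 These form, in order, the sequence $\mathbf x^{\mathrm p}$ of length $N_c=2\lambda K$. The remaining bits of $\mathbf x^{\mathrm{TC}}$ form the sequence $\mathbf x^{\mathrm{ch}}$ of length $2K-N_c$. The patch is an arbitrary permutation $\Pi_c$ of the $N_c$ positions of $\mathbf x^{\mathrm p}$ followed by an arbitrary rate-1 encoder, i.e. an encoding map $\mathbb{F}_2^{N_c}\to\mathbb{F}_2^{N_c}$, subject only to mapping the all-zero sequence to the all-zero sequence. Its output is $\mathbf x_c$. The 3D-TC is the set of all words $(\mathbf u,\mathbf x^{\mathrm{ch}},\mathbf x_c)\in\mathbb{F}_2^{3K}$ obtained this way, and its minimum distance is the minimum Hamming distance between two distinct codewords. *)

theory Defs
  imports Complex_Main "HOL-Library.Z2" "HOL-Library.Extended_Nat"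
    "HOL-Combinatorics.Permutations" "HOL-Number_Theory.Cong"
begin

definition quad_poly :: "nat \<Rightarrow> nat \<Rightarrow> nat \<Rightarrow> nat \<Rightarrow> nat" where
  "quad_poly M a1 a2 x = (a1 * x + a2 * x\<^sup>2) mod M"

definition is_qpp :: "nat \<Rightarrow> nat \<Rightarrow> nat \<Rightarrow> bool" where
  "is_qpp M a1 a2 \<longleftrightarrow> M \<ge> 2 \<and> bij_betw (quad_poly M a1 a2) {0..<M} {0..<M}"

definition has_quadratic_inverse :: "nat \<Rightarrow> nat \<Rightarrow> nat \<Rightarrow> nat \<Rightarrow> nat \<Rightarrow> bool" where
  "has_quadratic_inverse M f1 f2 g1 g2 \<longleftrightarrow>
     is_qpp M f1 f2 \<and> is_qpp M g1 g2 \<and>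
     (\<forall>x<M. quad_poly M g1 g2 (quad_poly M f1 f2 x) = x)"

definition cyc_nth :: "'a list \<Rightarrow> int \<Rightarrow> 'a" where
  "cyc_nth xs t = xs ! nat (t mod int (length xs))"

text \<open>
  The list \<open>s\<close> is the sequence of shift-register inputs of a recursive encoder with feedback
  polynomial \<open>1 + D^2 + D^3\<close> and feedforward polynomial \<open>1 + D + D^3\<close>. Reading it cyclically
  expresses that the initial and the final trellis state agree. This is a relation and not a
  function of the input: if 7 divides \<open>K\<close>, some inputs have no parity sequence and the others
  have several.
\<close>
definition tailbiting_valid :: "nat \<Rightarrow> bit list \<Rightarrow> bit list \<Rightarrow> bool" where
  "tailbiting_valid K v y \<longleftrightarrow> length v = K \<and> length y = K \<and>
     (\<exists>s. length s = K \<and>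
        (\<forall>t<K. v ! t = cyc_nth s (int t) + cyc_nth s (int t - 2) + cyc_nth s (int t - 3) \<and>
               y ! t = cyc_nth s (int t) + cyc_nth s (int t - 1) + cyc_nth s (int t - 3)))"

definition is_interleaved :: "nat \<Rightarrow> (nat \<Rightarrow> nat) \<Rightarrow> bit list \<Rightarrow> bit list \<Rightarrow> bool" where
  "is_interleaved K f u u' \<longleftrightarrow> length u = K \<and> length u' = K \<and> (\<forall>i<K. u' ! f i = u ! i)"

definition alternate :: "'a list \<Rightarrow> 'a list \<Rightarrow> 'a list" where
  "alternate xs ys = concat (map2 (\<lambda>x y. [x, y]) xs ys)"

definition regular_pattern :: "real \<Rightarrow> bool list" where
  "regular_pattern lam = [True, True] @ replicate (nat \<lfloor>2 / lam\<rfloor> - 2) False"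

definition pattern_positions :: "bool list \<Rightarrow> nat set" where
  "pattern_positions p = {j. p ! (j mod length p)}"

definition patch_part :: "real \<Rightarrow> 'a list \<Rightarrow> 'a list" where
  "patch_part lam xs = nths xs (pattern_positions (regular_pattern lam))"

definition channel_part :: "real \<Rightarrow> 'a list \<Rightarrow> 'a list" where
  "channel_part lam xs = nths xs (- pattern_positions (regular_pattern lam))"

text \<open>
  A patch consists of a permutation \<open>P\<close> of the positions and of an encoding map \<open>E\<close> on words of
  length \<open>N\<close>, which need neither be linear nor injective.
\<close>
definition is_patch :: "nat \<Rightarrow> (nat \<Rightarrow> nat) \<Rightarrow> (bit list \<Rightarrow> bit list) \<Rightarrow> bool" where
  "is_patch N P E \<longleftrightarrow> P permutes {..<N} \<and>
     (\<forall>w. length w = N \<longrightarrow> length (E w) = N) \<and> E (replicate N 0) = replicate N 0"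

definition turbo_code_3d ::
    "nat \<Rightarrow> real \<Rightarrow> (nat \<Rightarrow> nat) \<Rightarrow> (nat \<Rightarrow> nat) \<Rightarrow> (bit list \<Rightarrow> bit list) \<Rightarrow> bit list set" where
  "turbo_code_3d K lam f P E =
     {u @ channel_part lam (alternate xa xb) @ E (permute_list P (patch_part lam (alternate xa xb)))
       | u u' xa xb. is_interleaved K f u u' \<and> tailbiting_valid K u xa \<and> tailbiting_valid K u' xb}"

definition hamming_dist :: "'a list \<Rightarrow> 'a list \<Rightarrow> nat" where
  "hamming_dist xs ys = card {i. i < length xs \<and> xs ! i \<noteq> ys ! i}"

text \<open>
  With values in \<^typ>\<open>enat\<close>, a code with fewer than two words has minimum distance \<open>\<infinity>\<close>, so a finite
  upper bound includes the existence of two distinct codewords.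
\<close>
definition min_distance :: "'a list set \<Rightarrow> enat" where
  "min_distance C = Inf {enat (hamming_dist c d) | c d. c \<in> C \<and> d \<in> C \<and> c \<noteq> d}"

end

theory Submission
  imports Defs
begin

text \<open>
  The encoder input \<open>1 + D + D^5\<close> has the parity output \<open>1 + D^4 + D^5\<close>. If \<open>2 g\<^sub>2 = 0\<close> modulo \<open>K\<close>,
  then \<open>g\<close> is additive modulo \<open>K\<close>, and the nine positions \<open>p + a + g(d)\<close> with \<open>a\<close> and \<open>d\<close> in
  \<open>{0, 1, 5}\<close> split into three translates of \<open>{0, 1, 5}\<close> for the upper encoder and, after
  interleaving, into three such translates for the lower encoder. This gives weight at most
  \<open>9 + 9 + 9\<close>. Modulo 4 the parity positions lie in \<open>p + {0, 1} + {0, h}\<close> with \<open>h = g(1)\<close> odd, and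
  in a set of the same shape for the lower encoder. A suitable \<open>p\<close> keeps both away from 0, so no
  parity bit enters the patch.

  If only \<open>4 g\<^sub>2 = 0\<close> modulo \<open>K\<close>, then \<open>g\<close> is additive up to \<open>W = 2 g\<^sub>2\<close>, which has order two
  modulo \<open>K\<close>. Doubling the pattern by its translate by \<open>W\<close> absorbs this defect.
\<close>

declare add_bit_eq_xor [simp del] bit_not_zero_iff [simp del]

section \<open>Binary words as lists of positions modulo \<open>K\<close>\<close>

text \<open>An element of the group algebra of Z_K over F_2, listed by exponents. Coinciding
  positions cancel, so distinctness modulo \<open>K\<close> never has to be shown.\<close>

definition parity_at :: "nat \<Rightarrow> int list \<Rightarrow> int \<Rightarrow> bit" where
  "parity_at K ps t = (\<Sum>p\<leftarrow>ps. if [t = p] (mod int K) then 1 else 0)"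

definition word :: "nat \<Rightarrow> int list \<Rightarrow> bit list" where
  "word K ps = map (\<lambda>t. parity_at K ps (int t)) [0..<K]"

text \<open>The product in that group algebra: exponents add, and multiplicities are kept.\<close>

definition sumlist :: "int list \<Rightarrow> int list \<Rightarrow> int list" where
  "sumlist xs ys = concat (map (\<lambda>x. map ((+) x) ys) xs)"

text \<open>\<open>add_ac\<close> makes equal bits adjacent; this form cancels a pair at the head of
  a longer sum.\<close>

lemma bit_double: "x + (x + y) = y" for x y :: bit
  by (cases x; cases y) simp_all

lemma length_sumlist [simp]: "length (sumlist xs ys) = length xs * length ys"
  by (induction xs) (auto simp: sumlist_def)

lemma set_sumlist: "set (sumlist xs ys) = {x + y | x y. x \<in> set xs \<and> y \<in> set ys}"
  by (auto simp: sumlist_def)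

lemma length_word [simp]: "length (word K ps) = K"
  by (simp add: word_def)

lemma nth_word: "t < K \<Longrightarrow> word K ps ! t = parity_at K ps (int t)"
  by (simp add: word_def)

lemma parity_at_Nil [simp]: "parity_at K [] t = 0"
  by (simp add: parity_at_def)

lemma parity_at_append: "parity_at K (ps @ qs) t = parity_at K ps t + parity_at K qs t"
  by (simp add: parity_at_def)

lemma parity_at_cong:
  assumes "[t = t'] (mod int K)"
  shows "parity_at K ps t = parity_at K ps t'"
proof -
  have "[t = p] (mod int K) \<longleftrightarrow> [t' = p] (mod int K)" for p
    using assms cong_sym cong_trans by blast
  then show ?thesis by (simp add: parity_at_def)
qed

lemma parity_at_map_add: "parity_at K (map ((+) x) ps) t = parity_at K ps (t - x)"
proof -
  have "[t = x + p] (mod int K) \<longleftrightarrow> [t - x = p] (mod int K)" for p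
    by (simp add: cong_iff_dvd_diff algebra_simps)
  then show ?thesis by (simp add: parity_at_def o_def)
qed

text \<open>The map \<open>h\<close> is general because it will be the quadratic polynomial, under
  which adding \<open>x\<close> is not a mere shift.\<close>

lemma parity_at_map_sumlist:
  "parity_at K (map h (sumlist xs ys)) t = (\<Sum>x\<leftarrow>xs. parity_at K (map (\<lambda>y. h (x + y)) ys) t)"
  by (induction xs) (simp_all add: sumlist_def parity_at_append o_def)

lemma parity_at_map_sumlist':
  "parity_at K (map h (sumlist xs ys)) t = (\<Sum>y\<leftarrow>ys. parity_at K (map (\<lambda>x. h (x + y)) xs) t)"
proof (induction xs)
  case (Cons x xs)
  then show ?case
    by (simp add: parity_at_def sumlist_def sum_list_addf o_def)
qed (simp add: parity_at_map_sumlist)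

lemma parity_at_sumlist: "parity_at K (sumlist xs ys) t = (\<Sum>y\<leftarrow>ys. parity_at K xs (t - y))"
  using parity_at_map_sumlist'[of K "\<lambda>x. x" xs ys t] by (simp add: parity_at_map_add add.commute flip: parity_at_map_add)

lemma cyc_nth_word:
  assumes "K > 0"
  shows "cyc_nth (word K ps) t = parity_at K ps t"
proof -
  have "nat (t mod int K) < K" using assms by (simp add: nat_less_iff)
  then show ?thesis
    using assms by (auto simp: cyc_nth_def nth_word intro!: parity_at_cong)
qed

text \<open>
  Uses \<open>(1 + D + D^2)(1 + D^2 + D^3) = 1 + D + D^5\<close> and
  \<open>(1 + D + D^2)(1 + D + D^3) = 1 + D^4 + D^5\<close> over the field with two elements.
\<close>
lemma tailbiting_valid_word:
  assumes "K > 0"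
  shows "tailbiting_valid K (word K (sumlist qs [0, 1, 5])) (word K (sumlist qs [0, 4, 5]))"
  unfolding tailbiting_valid_def
proof (intro conjI exI[of _ "word K (sumlist qs [0, 1, 2])"] allI impI)
  fix t assume "t < K"
  then show "word K (sumlist qs [0, 1, 5]) ! t =
      cyc_nth (word K (sumlist qs [0, 1, 2])) (int t) +
      cyc_nth (word K (sumlist qs [0, 1, 2])) (int t - 2) +
      cyc_nth (word K (sumlist qs [0, 1, 2])) (int t - 3)"
    and "word K (sumlist qs [0, 4, 5]) ! t =
      cyc_nth (word K (sumlist qs [0, 1, 2])) (int t) +
      cyc_nth (word K (sumlist qs [0, 1, 2])) (int t - 1) +
      cyc_nth (word K (sumlist qs [0, 1, 2])) (int t - 3)"
    using assms by (simp_all add: cyc_nth_word nth_word parity_at_sumlist bit_double add_ac)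
qed simp_all

section \<open>Weight and nonvanishing of words\<close>

lemma weight_parity_at:
  "card {t. t < K \<and> parity_at K ps (int t) \<noteq> 0} \<le> length ps"
proof (induction ps)
  case (Cons p ps)
  have "{t. t < K \<and> parity_at K (p # ps) (int t) \<noteq> 0} \<subseteq>
      {t. t < K \<and> parity_at K ps (int t) \<noteq> 0} \<union> {nat (p mod int K)}"
    by (auto simp: parity_at_def cong_def split: if_splits)
  then have "card {t. t < K \<and> parity_at K (p # ps) (int t) \<noteq> 0} \<le>
      card ({t. t < K \<and> parity_at K ps (int t) \<noteq> 0} \<union> {nat (p mod int K)})"
    by (intro card_mono) auto
  also have "\<dots> \<le> card {t. t < K \<and> parity_at K ps (int t) \<noteq> 0} + 1"
    using card_Un_le[of _ "{nat (p mod int K)}"] by simp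
  finally show ?case using Cons by simp
qed simp

lemma weight_word: "length (filter (\<lambda>x. x \<noteq> 0) (word K ps)) \<le> length ps"
proof -
  have "{t. t < K \<and> word K ps ! t \<noteq> 0} = {t. t < K \<and> parity_at K ps (int t) \<noteq> 0}"
    by (auto simp: nth_word)
  then show ?thesis
    using weight_parity_at[of K ps] by (simp add: length_filter_conv_card)
qed

lemma parity_at_neq_0D:
  assumes "parity_at K ps t \<noteq> 0"
  obtains p where "p \<in> set ps" "[t = p] (mod int K)"
proof -
  have "\<exists>p\<in>set ps. [t = p] (mod int K)"
    using assms by (induction ps) (auto simp: parity_at_def split: if_splits)
  then show thesis using that by blast
qed

text \<open>Each entry of the list meets exactly one residue. Hence an odd number of positions
  cannot cancel completely.\<close>

lemma sum_parity_at:
  assumes "K > 0"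
  shows "(\<Sum>t<K. parity_at K ps (int t)) = of_nat (length ps)"
proof (induction ps)
  case (Cons p ps)
  have "(\<Sum>t<K. if [int t = p] (mod int K) then 1 else 0 :: bit) =
      (\<Sum>t<K. if t = nat (p mod int K) then 1 else 0)"
    using assms by (intro sum.cong) (auto simp: cong_def)
  also have "\<dots> = 1"
    using assms by (simp add: nat_less_iff)
  finally have "(\<Sum>t<K. if [int t = p] (mod int K) then 1 else 0 :: bit) = 1" .
  then show ?case
    using Cons by (simp add: parity_at_def sum.distrib)
qed simp

lemma parity_at_odd_neq_0:
  assumes "K > 0" "odd (length ps)"
  shows "\<exists>t<K. parity_at K ps (int t) \<noteq> 0"
proof (rule ccontr)
  assume "\<not> (\<exists>t<K. parity_at K ps (int t) \<noteq> 0)"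
  then have "(\<Sum>t<K. parity_at K ps (int t)) = 0" by simp
  then have "of_nat (length ps) = (0 :: bit)" using assms by (simp add: sum_parity_at)
  then show False using assms by (metis even_of_nat dvd_0_right)
qed

text \<open>A word that is invariant under a shift by half the period has even weight.\<close>
lemma parity_at_doubled_odd_neq_0:
  assumes K: "K > 0" and odd: "odd (length ps)"
    and W: "[2 * W = 0] (mod int K)" "\<not> [W = 0] (mod int K)"
  shows "\<exists>t<K. parity_at K (sumlist ps [0, W]) (int t) \<noteq> 0"
proof (rule ccontr)
  assume "\<not> (\<exists>t<K. parity_at K (sumlist ps [0, W]) (int t) \<noteq> 0)"
  then have *: "parity_at K ps (int t) + parity_at K ps (int t - W) = 0" if "t < K" for t
    using that by (simp add: parity_at_sumlist)
  obtain q where q: "2 * W = int K * q"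
    using W(1) by (auto simp: cong_0_iff)
  have "odd q"
    using W(2) q by (auto simp: cong_0_iff elim!: evenE)
  moreover from this have "even K"
    using q by (metis dvd_triv_left even_mult_iff even_of_nat)
  ultimately obtain M r where M: "K = 2 * M" and r: "q = 2 * r + 1"
    by (auto elim!: evenE oddE)
  \<comment> \<open>So \<open>W\<close> is congruent to \<open>K / 2\<close>, and subtracting it
    amounts to adding it.\<close>
  have "W = int M + int K * r"
    using q M r by (simp add: algebra_simps)
  then have "[int t - W = int t + int M] (mod int K)" for t
    using M by (auto simp: cong_iff_dvd_diff intro!: dvdI[of _ _ "- r - 1"] simp: algebra_simps)
  then have **: "parity_at K ps (int t) + parity_at K ps (int t + int M) = 0" if "t < K" for t
    using * that parity_at_cong by metis
  \<comment> \<open>Both halves of the period contribute the same bits, so the total is 0.\<close>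
  have "(\<Sum>t<K. parity_at K ps (int t)) =
      (\<Sum>t<M. parity_at K ps (int t)) + (\<Sum>t=M..<K. parity_at K ps (int t))"
    using M by (simp add: sum.atLeastLessThan_concat flip: atLeast0LessThan)
  also have "(\<Sum>t=M..<K. parity_at K ps (int t)) = (\<Sum>t<M. parity_at K ps (int (t + M)))"
    using M sum.shift_bounds_nat_ivl[of "\<lambda>t. parity_at K ps (int t)" 0 M M]
    by (simp add: atLeast0LessThan mult_2)
  also have "(\<Sum>t<M. parity_at K ps (int t)) + (\<Sum>t<M. parity_at K ps (int (t + M))) = 0"
    unfolding sum.distrib[symmetric] using ** M by (intro sum.neutral) simp
  finally have "of_nat (length ps) = (0 :: bit)" using K by (simp add: sum_parity_at)
  then show False using odd by (metis even_of_nat dvd_0_right)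
qed

section \<open>Alternation and puncturing\<close>

lemma length_filter_nths_le: "length (filter P (nths xs I)) \<le> length (filter P xs)"
proof (induction xs arbitrary: I)
  case (Cons x xs)
  show ?case using Cons[of "{j. Suc j \<in> I}"] by (simp add: nths_Cons)
qed simp

lemma length_alternate: "length xs = length ys \<Longrightarrow> length (alternate xs ys) = 2 * length xs"
  by (induction xs ys rule: list_induct2) (simp_all add: alternate_def)

lemma set_alternate_subset: "set (alternate xs ys) \<subseteq> set xs \<union> set ys"
  by (auto simp: alternate_def dest: set_zip_leftD set_zip_rightD)

lemma length_filter_alternate:
  "length xs = length ys \<Longrightarrow>
    length (filter P (alternate xs ys)) = length (filter P xs) + length (filter P ys)"
  by (induction xs ys rule: list_induct2) (simp_all add: alternate_def)

lemma nth_alternate: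
  "length xs = length ys \<Longrightarrow> j < 2 * length xs \<Longrightarrow>
    alternate xs ys ! j = (if even j then xs else ys) ! (j div 2)"
proof (induction xs ys arbitrary: j rule: list_induct2)
  case (Cons x xs y ys)
  show ?case
  proof (cases "j < 2")
    case True
    then have "j = 0 \<or> j = 1" by auto
    then show ?thesis by (auto simp: alternate_def)
  next
    case False
    then obtain i where "j = i + 2" by (metis add.commute le_Suc_ex not_less)
    then show ?thesis using Cons by (simp add: alternate_def)
  qed
qed simp

lemma pattern_positions_regular_pattern:
  assumes "1 / lam = real L" "L > 0"
  shows "pattern_positions (regular_pattern lam) = {j. j mod (2 * L) < 2}"
proof -
  have "2 / lam = real (2 * L)"
    using assms(1) by (simp add: field_simps)
  then have "nat \<lfloor>2 / lam\<rfloor> = 2 * L"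
    by (simp only: floor_of_nat nat_int)
  then have p: "regular_pattern lam = [True, True] @ replicate (2 * L - 2) False"
    by (simp add: regular_pattern_def)
  have "regular_pattern lam ! k \<longleftrightarrow> k < 2" if "k < 2 * L" for k
    using that unfolding p nth_append by (auto simp: less_2_cases_iff)
  moreover have "length (regular_pattern lam) = 2 * L"
    using assms(2) unfolding p by simp
  ultimately show ?thesis
    using assms(2) by (simp add: pattern_positions_def)
qed

text \<open>Division with remainder by \<open>m\<close> pairs a quotient below \<open>n\<close> with
  a remainder below \<open>r\<close>. This counts the patch bits.\<close>

lemma card_mod_less:
  fixes m n r :: nat
  assumes "r \<le> m"
  shows "card {j. j < m * n \<and> j mod m < r} = n * r"
proof (cases "r = 0")
  case False
  have "bij_betw (\<lambda>(a, b). m * a + b) ({..<n} \<times> {..<r}) {j. j < m * n \<and> j mod m < r}"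
  proof (rule bij_betw_byWitness[where f' = "\<lambda>j. (j div m, j mod m)"])
    have "m * a + b < m * n" if "a < n" "b < r" for a b
    proof -
      have "m * a + b < m * Suc a" using that assms by simp
      also have "m * Suc a \<le> m * n" using that by (intro mult_le_mono2) simp
      finally show ?thesis .
    qed
    then show "(\<lambda>(a, b). m * a + b) ` ({..<n} \<times> {..<r}) \<subseteq> {j. j < m * n \<and> j mod m < r}"
      using assms by auto
  qed (use assms False in \<open>auto simp: less_mult_imp_div_less mult.commute\<close>)
  then show ?thesis by (simp add: bij_betw_same_card[symmetric])
qed simp

text \<open>Index \<open>j\<close> of the alternating sequence carries bit \<open>j div 2\<close> of
  one of the two words, and \<open>j mod (2 * L) < 2\<close> forces \<open>L\<close> to divide
  \<open>j div 2\<close>.\<close>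

lemma patch_part_alternate_zero:
  fixes xa xb :: "'a :: zero list"
  assumes L: "1 / lam = real L" "L > 0" "L dvd K"
    and len: "length xa = K" "length xb = K"
    and zero: "\<And>t. t < K \<Longrightarrow> L dvd t \<Longrightarrow> xa ! t = 0 \<and> xb ! t = 0"
  shows "patch_part lam (alternate xa xb) = replicate (2 * (K div L)) 0"
proof -
  have pos: "pattern_positions (regular_pattern lam) = {j. j mod (2 * L) < 2}"
    using L by (intro pattern_positions_regular_pattern)
  have "length (patch_part lam (alternate xa xb)) = card {j. j < 2 * L * (K div L) \<and> j mod (2 * L) < 2}"
    using L(3) len by (auto simp: patch_part_def pos length_nths length_alternate mult.assoc elim!: dvdE)
  also have "\<dots> = 2 * (K div L)"
    using L by (subst card_mod_less) auto
  finally have length: "length (patch_part lam (alternate xa xb)) = 2 * (K div L)" .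
  have "x = 0" if x: "x \<in> set (patch_part lam (alternate xa xb))" for x
  proof -
    obtain j where j: "j < 2 * K" "j mod (2 * L) < 2" "x = alternate xa xb ! j"
      using x len by (auto simp: patch_part_def pos set_nths length_alternate)
    have "j mod (2 * L) = 2 * (j div 2 mod L) + j mod 2"
      by (simp add: mod_mult2_eq)
    then have "j div 2 mod L = 0" using j(2) by linarith
    then have "L dvd j div 2" by (simp add: mod_eq_0_iff_dvd)
    then show ?thesis
      using j zero[of "j div 2"] len by (simp add: nth_alternate)
  qed
  then show ?thesis
    using length replicate_eqI by metis
qed

section \<open>Distance from the zero codeword\<close>

lemma hamming_dist_zero:
  fixes xs ys :: "'a :: zero list"
  assumes "length ys = length xs" "set ys \<subseteq> {0}"
  shows "hamming_dist xs ys = length (filter (\<lambda>x. x \<noteq> 0) xs)"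
proof -
  have "ys ! i = 0" if "i < length xs" for i
    using that assms nth_mem[of i ys] by (simp add: subset_iff)
  then show ?thesis
    unfolding hamming_dist_def length_filter_conv_card by (metis (no_types, opaque_lifting))
qed

lemma min_distance_le:
  assumes "c \<in> C" "d \<in> C" "c \<noteq> d" "hamming_dist c d \<le> n"
  shows "min_distance C \<le> enat n"
proof -
  have "min_distance C \<le> enat (hamming_dist c d)"
    unfolding min_distance_def using assms by (intro Inf_lower) blast
  then show ?thesis using assms(4) by (meson enat_ord_simps(1) order_trans)
qed

text \<open>
  Since all patch bits of the word vanish, the patch outputs zero, whatever its encoder does
  elsewhere.
\<close>
lemma min_distance_turbo_code_3d_le:
  fixes K L Nc :: nat and lam :: real
  assumes K: "K > 0" and L: "1 / lam = real L" "L > 0" "L dvd K"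
    and Nc: "real Nc = 2 * lam * real K" and patch: "is_patch Nc P E"
    and u: "is_interleaved K f u u'" "u \<noteq> replicate K 0" and f: "\<And>i. i < K \<Longrightarrow> f i < K"
    and valid: "tailbiting_valid K u xa" "tailbiting_valid K u' xb"
    and zero: "\<And>t. t < K \<Longrightarrow> L dvd t \<Longrightarrow> xa ! t = 0 \<and> xb ! t = 0"
    and weight: "length (filter (\<lambda>x. x \<noteq> 0) u) + length (filter (\<lambda>x. x \<noteq> 0) xa) +
      length (filter (\<lambda>x. x \<noteq> 0) xb) \<le> n"
  shows "min_distance (turbo_code_3d K lam f P E) \<le> enat n"
proof -
  define z :: "bit list" where "z = replicate K 0"
  have len: "length u = K" "length xa = K" "length xb = K"
    using valid by (simp_all add: tailbiting_valid_def)
  \<comment> \<open>Division by zero gives 0, so \<open>lam = 0\<close> would contradict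
    \<open>L > 0\<close>.\<close>
  have "lam * real L = 1" using L by (cases "lam = 0") (simp_all add: field_simps)
  moreover have "real K = real L * real (K div L)" using L by (simp flip: of_nat_mult)
  ultimately have "real Nc = real (2 * (K div L))" using Nc by simp
  then have Nc': "Nc = 2 * (K div L)" by (simp only: of_nat_eq_iff)
  have "P i < Nc" if "i < Nc" for i
    using that patch permutes_in_image[of P "{..<Nc}" i] by (simp add: is_patch_def)
  then have "permute_list P (replicate Nc 0) = replicate Nc (0 :: bit)"
    by (intro replicate_eqI) (auto simp: permute_list_def)
  then have E: "E (permute_list P (patch_part lam (alternate ya yb))) = replicate Nc 0"
    if "length ya = K" "length yb = K"
      "\<And>t. t < K \<Longrightarrow> L dvd t \<Longrightarrow> ya ! t = 0 \<and> yb ! t = 0" for ya yb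
    using patch_part_alternate_zero[OF L that] patch by (simp add: is_patch_def Nc')
  \<comment> \<open>The zero register sequence selects the zero parity word, even if the zero input
    admits others.\<close>
  have "tailbiting_valid K z z"
    unfolding tailbiting_valid_def z_def
    by (auto intro!: exI[of _ "replicate K 0"] simp: cyc_nth_def nat_less_iff K)
  moreover have "is_interleaved K f z z"
    using f by (simp add: is_interleaved_def z_def)
  moreover have "E (permute_list P (patch_part lam (alternate z z))) = replicate Nc 0"
    by (intro E) (simp_all add: z_def)
  ultimately have "z @ channel_part lam (alternate z z) @ replicate Nc 0 \<in> turbo_code_3d K lam f P E"
    unfolding turbo_code_3d_def by force
  moreover have "u @ channel_part lam (alternate xa xb) @ replicate Nc 0 \<in> turbo_code_3d K lam f P E"
    unfolding turbo_code_3d_def using u valid E[OF len(2,3) zero] by force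
  moreover have "hamming_dist (u @ channel_part lam (alternate xa xb) @ replicate Nc 0)
      (z @ channel_part lam (alternate z z) @ replicate Nc 0) \<le> n" (is "hamming_dist ?c ?d \<le> n")
  proof -
    have "length ?d = length ?c"
      using len by (simp add: z_def channel_part_def length_nths length_alternate)
    moreover have "set ?d \<subseteq> {0}"
      using set_alternate_subset[of z z]
      by (auto simp: z_def channel_part_def dest!: in_set_nthsD)
    ultimately have "hamming_dist ?c ?d = length (filter (\<lambda>x. x \<noteq> 0) ?c)"
      by (rule hamming_dist_zero)
    also have "\<dots> \<le> length (filter (\<lambda>x. x \<noteq> 0) u) + length (filter (\<lambda>x. x \<noteq> 0) (alternate xa xb))"
      by (simp add: channel_part_def length_filter_nths_le)
    also have "\<dots> \<le> n"
      using weight len by (simp add: length_filter_alternate)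
    finally show ?thesis .
  qed
  ultimately show ?thesis
    using u(2) len by (intro min_distance_le) (auto simp: z_def)
qed

section \<open>Quadratic permutation polynomials modulo \<open>K\<close> and modulo 4\<close>

text \<open>Left unreduced, so that identities hold over the integers and serve for congruences
  modulo \<open>K\<close> and modulo 4 alike.\<close>

definition quad_int :: "nat \<Rightarrow> nat \<Rightarrow> int \<Rightarrow> int" where
  "quad_int a1 a2 x = int a1 * x + int a2 * x\<^sup>2"

lemma int_quad_poly: "int (quad_poly M a1 a2 x) = quad_int a1 a2 (int x) mod int M"
  by (simp add: quad_poly_def quad_int_def zmod_int)

lemma quad_int_cong:
  assumes "[x = y] (mod m)"
  shows "[quad_int a1 a2 x = quad_int a1 a2 y] (mod m)"
  unfolding quad_int_def using assms by (intro cong_add cong_mult cong_pow cong_refl)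

lemma quad_int_surj:
  assumes "is_qpp K g1 g2"
  obtains b where "[quad_int g1 g2 b = q] (mod int K)"
proof -
  have K: "K > 0" and surj: "quad_poly K g1 g2 ` {0..<K} = {0..<K}"
    using assms by (auto simp: is_qpp_def bij_betw_def)
  have "nat (q mod int K) \<in> {0..<K}" using K by (simp add: nat_less_iff)
  then have "nat (q mod int K) \<in> quad_poly K g1 g2 ` {0..<K}" using surj by simp
  then obtain x where "quad_poly K g1 g2 x = nat (q mod int K)" by (metis imageE)
  then have "quad_int g1 g2 (int x) mod int K = q mod int K"
    using K by (simp flip: int_quad_poly)
  then show thesis using that by (simp add: cong_def)
qed

text \<open>This moves positions from the lower to the upper encoder. The direction from right to
  left rests on the injectivity of \<open>g\<close>.\<close>

lemma cong_inverse_iff: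
  assumes "has_quadratic_inverse K f1 f2 g1 g2" "i < K"
  shows "[int (quad_poly K f1 f2 i) = x] (mod int K) \<longleftrightarrow> [int i = quad_int g1 g2 x] (mod int K)"
proof -
  let ?f = "quad_poly K f1 f2" and ?g = "quad_poly K g1 g2"
  have K: "K > 0" and inj: "inj_on ?g {0..<K}" and gf: "?g (?f i) = i"
    using assms by (auto simp: has_quadratic_inverse_def is_qpp_def bij_betw_def)
  have "[int i = quad_int g1 g2 (int (?f i))] (mod int K)"
    using int_quad_poly[of K g1 g2 "?f i"] gf by (simp add: cong_def)
  moreover have "[int (?f i) = x] (mod int K)" if "[int i = quad_int g1 g2 x] (mod int K)"
  proof -
    define y where "y = nat (x mod int K)"
    have y: "y < K" "[int y = x] (mod int K)"
      using K by (auto simp: y_def nat_less_iff cong_def)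
    then have "[int i = quad_int g1 g2 (int y)] (mod int K)"
      using that quad_int_cong cong_sym cong_trans by blast
    then have "int (?g y) = int i"
      using assms(2) by (simp add: int_quad_poly cong_def)
    then have "?g y = ?g (?f i)" using gf by simp
    moreover have "?f i < K" using K by (simp add: quad_poly_def)
    ultimately have "y = ?f i" using y(1) inj by (simp add: inj_on_def)
    then show ?thesis using y(2) by simp
  qed
  ultimately show ?thesis
    using quad_int_cong cong_trans by blast
qed

lemma qpp_coeff_parity:
  assumes "is_qpp K g1 g2" "4 dvd K"
  shows "odd g1" "even g2"
proof -
  have m4: "\<exists>b. [quad_int g1 g2 b = q] (mod 4)" for q
  proof -
    obtain b where "[quad_int g1 g2 b = q] (mod int K)"
      using quad_int_surj[OF assms(1)] .
    then show ?thesis using assms(2) cong_dvd_modulus by (metis of_nat_dvd_iff of_nat_numeral)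
  qed
  \<comment> \<open>The value 1 forces \<open>g1 + g2\<close> to be odd. The value 2 then needs an
    even argument, where an even \<open>g1\<close> would give a multiple of 4.\<close>
  obtain b c where b: "[quad_int g1 g2 b = 1] (mod 4)" and c: "[quad_int g1 g2 c = 2] (mod 4)"
    using m4 by blast
  have "odd (quad_int g1 g2 b)" "even (quad_int g1 g2 c)" "\<not> 4 dvd quad_int g1 g2 c"
    using b c by (simp_all add: cong_def) presburger+
  then have "odd (g1 + g2)" "even c" and c4: "\<not> 4 dvd quad_int g1 g2 c"
    by (auto simp: quad_int_def)
  moreover have "odd g1"
  proof
    assume "even g1"
    then have "4 dvd int g1 * c" "4 dvd int g2 * c\<^sup>2"
      using \<open>even c\<close> by (auto elim!: evenE simp: power2_eq_square)
    then show False using c4 by (simp add: quad_int_def)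
  qed
  ultimately show "odd g1" "even g2" by auto
qed

text \<open>The differences are \<open>(g1 - 1) * b + g2 * b^2\<close> and
  \<open>g2 * b * (b - 1)\<close>, in which every term has two even factors.\<close>

lemma quad_int_mod_4:
  assumes "odd g1" "even g2"
  shows "even b \<Longrightarrow> 4 dvd quad_int g1 g2 b - b"
    and "odd b \<Longrightarrow> 4 dvd quad_int g1 g2 b - quad_int g1 g2 1 * b"
proof -
  assume "even b"
  then obtain k where "b = 2 * k" by blast
  moreover obtain m where "g1 = 2 * m + 1" using assms(1) oddE by blast
  ultimately have "quad_int g1 g2 b - b = 4 * (int m * k + int g2 * k\<^sup>2)"
    by (simp add: quad_int_def algebra_simps power2_eq_square)
  then show "4 dvd quad_int g1 g2 b - b" by simp
next
  assume "odd b"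
  then obtain k where "b = 2 * k + 1" using oddE by blast
  moreover obtain m where "g2 = 2 * m" using assms(2) by blast
  ultimately have "quad_int g1 g2 b - quad_int g1 g2 1 * b = 4 * (int m * k * b)"
    by (simp add: quad_int_def algebra_simps power2_eq_square)
  then show "4 dvd quad_int g1 g2 b - quad_int g1 g2 1 * b" by simp
qed

text \<open>
  Modulo 4, the parity offsets 0, 4, 5 are 0 and 1, so the parity bits avoid the residue 0 if \<open>c\<close>
  and \<open>c + 1\<close> do for every start \<open>c\<close> of an excursion. The first claim concerns the upper and the
  second one the lower encoder. The witness is \<open>p = 1\<close> or \<open>p = 2\<close> according to whether
  \<open>g\<^sub>1 + g\<^sub>2\<close> is 1 or 3 modulo 4.
\<close>
lemma puncturing_offset:
  assumes "odd g1" "even g2"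
  obtains p where
    "\<And>d. d \<in> {0, 1, 5} \<Longrightarrow> \<not> 4 dvd p + quad_int g1 g2 d \<and> \<not> 4 dvd p + quad_int g1 g2 d + 1"
    "\<And>a b. a \<in> {0, 1, 5} \<Longrightarrow> [quad_int g1 g2 b = p + a] (mod 4) \<Longrightarrow> \<not> 4 dvd b \<and> \<not> 4 dvd b + 1"
proof -
  let ?G = "quad_int g1 g2"
  note G = quad_int_mod_4[OF assms]
  have G0: "?G 0 = 0" by (simp add: quad_int_def)
  have G5: "4 dvd ?G 5 - ?G 1" using G(2)[of 5] by simp presburger
  have "odd (?G 1)" using assms by (simp add: quad_int_def)
  then have "?G 1 mod 4 = 1 \<or> ?G 1 mod 4 = 3" by presburger
  then consider "?G 1 mod 4 = 1" | "?G 1 mod 4 = 3" by blast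
  then show thesis
  proof cases
    case 1
    \<comment> \<open>Here \<open>g\<close> is the identity modulo 4, so with \<open>p = 1\<close>
      all starts are 1 or 2 modulo 4.\<close>
    have "4 dvd ?G b - b" for b
    proof (cases "even b")
      case False
      have "4 dvd ?G 1 - 1" using 1 by presburger
      then have "4 dvd (?G b - ?G 1 * b) + (?G 1 - 1) * b"
        using G(2)[OF False] by (intro dvd_add[OF _ dvd_mult2])
      then show ?thesis by (simp add: algebra_simps)
    qed (rule G)
    then have G1: "4 dvd ?G b - b" for b .
    have "\<not> 4 dvd b \<and> \<not> 4 dvd b + 1" if "a \<in> {0, 1, 5}" "[?G b = 1 + a] (mod 4)" for a b
      using that G1[of b] unfolding cong_iff_dvd_diff by simp presburger
    moreover have "\<not> 4 dvd 1 + ?G d \<and> \<not> 4 dvd 1 + ?G d + 1" if "d \<in> {0, 1, 5}" for d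
      using that 1 G0 G5 by auto presburger+
    ultimately show thesis using that by blast
  next
    case 2
    \<comment> \<open>Modulo 4, \<open>g\<close> fixes even and negates odd arguments; with
      \<open>p = 2\<close> all starts are again 1 or 2.\<close>
    have G3: "4 dvd ?G b + b" if "odd b" for b
    proof -
      have "4 dvd ?G 1 + 1" using 2 by presburger
      then have "4 dvd (?G b - ?G 1 * b) + (?G 1 + 1) * b"
        using G(2)[OF that] by (intro dvd_add[OF _ dvd_mult2])
      then show ?thesis by (simp add: algebra_simps)
    qed
    have "\<not> 4 dvd b \<and> \<not> 4 dvd b + 1" if "a \<in> {0, 1, 5}" "[?G b = 2 + a] (mod 4)" for a b
      using that G(1)[of b] G3[of b] unfolding cong_iff_dvd_diff by simp presburger
    moreover have "\<not> 4 dvd 2 + ?G d \<and> \<not> 4 dvd 2 + ?G d + 1" if "d \<in> {0, 1, 5}" for d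
      using that 2 G0 G5 by auto presburger+
    ultimately show thesis using that by blast
  qed
qed

section \<open>The low-weight codeword\<close>

text \<open>Common core of both claims, with \<open>ws\<close> being \<open>[0]\<close> or
  \<open>[0, W]\<close>. The assumption \<open>shift\<close> says that \<open>g\<close> is additive
  up to a rearrangement of \<open>ws\<close> modulo \<open>K\<close>. Each of the three words has at
  most \<open>9 * length ws\<close> ones.\<close>

lemma min_distance_quad_le:
  fixes K L Nc :: nat and lam :: real
  assumes K: "K > 0" and L: "1 / lam = real L" "4 dvd L" "L dvd K"
    and inv: "has_quadratic_inverse K f1 f2 g1 g2"
    and Nc: "real Nc = 2 * lam * real K" and patch: "is_patch Nc P E"
    and ws4: "\<And>w. w \<in> set ws \<Longrightarrow> 4 dvd w"
    and shift: "\<And>b d t. parity_at K (map (\<lambda>w. quad_int g1 g2 (b + d + w)) ws) t =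
      parity_at K (map ((+) (quad_int g1 g2 b + quad_int g1 g2 d)) ws) t"
    and neq_0: "\<And>ps. odd (length ps) \<Longrightarrow> \<exists>t<K. parity_at K (sumlist ps ws) (int t) \<noteq> 0"
  shows "min_distance (turbo_code_3d K lam (quad_poly K f1 f2) P E) \<le> enat (27 * length ws)"
proof -
  let ?G = "quad_int g1 g2" and ?f = "quad_poly K f1 f2"
  have qpp: "is_qpp K g1 g2" using inv by (simp add: has_quadratic_inverse_def)
  have "4 dvd K" using L dvd_trans by blast
  note parity = qpp_coeff_parity[OF qpp this]
  have "L > 0" using K L(3) by (auto intro: Nat.gr0I)
  have mod4: "[x = y] (mod 4)" if "[x = y] (mod int K)" for x y
    using that \<open>4 dvd K\<close> cong_dvd_modulus by (metis of_nat_dvd_iff of_nat_numeral)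
  obtain p where
    p1: "\<And>d. d \<in> {0, 1, 5} \<Longrightarrow> \<not> 4 dvd p + ?G d \<and> \<not> 4 dvd p + ?G d + 1" and
    p2: "\<And>a b. a \<in> {0, 1, 5} \<Longrightarrow> [?G b = p + a] (mod 4) \<Longrightarrow> \<not> 4 dvd b \<and> \<not> 4 dvd b + 1"
    using puncturing_offset[OF parity] by metis
  \<comment> \<open>The start \<open>B a\<close> is, modulo \<open>K\<close>, the position to which
    the interleaver sends \<open>p + a\<close>.\<close>
  have "\<forall>a. \<exists>b. [?G b = p + a] (mod int K)"
    using quad_int_surj[OF qpp] by metis
  then obtain B where B: "\<And>a. [?G (B a) = p + a] (mod int K)" by metis
  define qa where "qa = sumlist [p, p + ?G 1, p + ?G 5] ws"
  define qb where "qb = sumlist [B 0, B 1, B 5] ws"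
  have no_patch: "word K (sumlist qs [0, 4, 5]) ! t = 0"
    if qs: "qs = sumlist cs ws" and t: "t < K" "L dvd t"
      and cs: "\<forall>c\<in>set cs. \<not> 4 dvd c \<and> \<not> 4 dvd c + 1" for qs cs t
  proof (rule ccontr)
    assume "word K (sumlist qs [0, 4, 5]) ! t \<noteq> 0"
    then obtain x where "x \<in> set (sumlist qs [0, 4, 5])" "[int t = x] (mod int K)"
      using t(1) by (metis nth_word parity_at_neq_0D)
    then obtain c w e where cwe: "c \<in> set cs" "w \<in> set ws" "e \<in> set [0, 4, 5]"
        and "[int t = c + w + e] (mod int K)"
      unfolding qs set_sumlist by blast
    then have "[int t = c + w + e] (mod 4)" using mod4 by blast
    moreover have "4 dvd int t"
      using t(2) L(2) dvd_trans by (metis of_nat_dvd_iff of_nat_numeral)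
    ultimately have "4 dvd c + w + e" using cong_dvd_iff by blast
    moreover have "4 dvd w" "\<not> 4 dvd c" "\<not> 4 dvd c + 1"
      using cwe cs ws4 by auto
    moreover have "e = 0 \<or> e = 4 \<or> e = 5" using cwe(3) by simp
    ultimately show False by presburger
  qed
  have "word K (sumlist qb [0, 1, 5]) ! ?f i = word K (sumlist qa [0, 1, 5]) ! i" if i: "i < K" for i
  proof -
    define r where "r x = parity_at K ws (int i - p - x)" for x
    have "word K (sumlist qb [0, 1, 5]) ! ?f i = parity_at K (sumlist qb [0, 1, 5]) (int (?f i))"
      using K by (simp add: nth_word quad_poly_def)
    \<comment> \<open>Reading at \<open>f i\<close> amounts to moving every position by
      \<open>g\<close> and reading at \<open>i\<close>.\<close>
    also have "\<dots> = parity_at K (map ?G (sumlist qb [0, 1, 5])) (int i)"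
      unfolding parity_at_def using cong_inverse_iff[OF inv i] by (simp add: o_def)
    also have "\<dots> = (\<Sum>d\<leftarrow>[0, 1, 5]. parity_at K (map (\<lambda>q. ?G (q + d)) qb) (int i))"
      by (rule parity_at_map_sumlist')
    also have "\<dots> = (\<Sum>d\<leftarrow>[0, 1, 5]. \<Sum>b\<leftarrow>[B 0, B 1, B 5].
        parity_at K (map (\<lambda>w. ?G (b + d + w)) ws) (int i))"
      unfolding qb_def parity_at_map_sumlist by (simp only: ac_simps)
    also have "\<dots> = (\<Sum>d\<leftarrow>[0, 1, 5]. \<Sum>b\<leftarrow>[B 0, B 1, B 5]. parity_at K ws (int i - (?G b + ?G d)))"
      by (simp only: shift parity_at_map_add)
    \<comment> \<open>By the choice of \<open>B\<close> only \<open>a + g(d)\<close> matters, so the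
      sum may be regrouped with \<open>g(d)\<close> as start and \<open>a\<close> as offset.\<close>
    also have "\<dots> = (\<Sum>d\<leftarrow>[0, 1, 5]. \<Sum>a\<leftarrow>[0, 1, 5]. r (a + ?G d))"
    proof -
      have "parity_at K ws (int i - (?G (B a) + ?G d)) = r (a + ?G d)" for a d
        unfolding r_def using cong_sym[OF B[of a]]
        by (intro parity_at_cong) (simp add: cong_iff_dvd_diff algebra_simps)
      then show ?thesis by simp
    qed
    also have "\<dots> = parity_at K (sumlist qa [0, 1, 5]) (int i)"
    proof -
      have "parity_at K qa (int i - a) = r (a + ?G 0) + r (a + ?G 1) + r (a + ?G 5)" for a
        using parity_at_map_sumlist[of K "\<lambda>x. x" "[p, p + ?G 1, p + ?G 5]" ws "int i - a"]
        by (simp add: qa_def parity_at_map_add r_def algebra_simps quad_int_def)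
      then show ?thesis by (simp add: parity_at_sumlist add_ac)
    qed
    also have "\<dots> = word K (sumlist qa [0, 1, 5]) ! i" using i by (simp add: nth_word)
    finally show ?thesis .
  qed
  then have "is_interleaved K ?f (word K (sumlist qa [0, 1, 5])) (word K (sumlist qb [0, 1, 5]))"
    by (simp add: is_interleaved_def)
  moreover have "word K (sumlist qa [0, 1, 5]) \<noteq> replicate K 0"
  proof -
    \<comment> \<open>Moving \<open>ws\<close> to the last factor leaves a list of nine positions,
      an odd number.\<close>
    have "parity_at K (sumlist qa [0, 1, 5]) t =
        parity_at K (sumlist (sumlist [p, p + ?G 1, p + ?G 5] [0, 1, 5]) ws) t" for t
      by (simp add: qa_def parity_at_sumlist parity_at_map_add sum_list_addf diff_diff_eq add.commute)
    then obtain t where "t < K" "parity_at K (sumlist qa [0, 1, 5]) (int t) \<noteq> 0"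
      using neq_0[of "sumlist [p, p + ?G 1, p + ?G 5] [0, 1, 5]"] by auto
    then show ?thesis by (metis nth_word nth_replicate)
  qed
  moreover have "?f i < K" for i using K by (simp add: quad_poly_def)
  moreover have "word K (sumlist qa [0, 4, 5]) ! t = 0 \<and> word K (sumlist qb [0, 4, 5]) ! t = 0"
    if "t < K" "L dvd t" for t
  proof
    show "word K (sumlist qa [0, 4, 5]) ! t = 0"
      using p1[of 0] p1[of 1] p1[of 5] by (intro no_patch[OF qa_def that]) (simp add: quad_int_def)
    show "word K (sumlist qb [0, 4, 5]) ! t = 0"
      using p2[OF _ mod4[OF B]] by (intro no_patch[OF qb_def that]) simp
  qed
  moreover have "length (filter (\<lambda>x. x \<noteq> 0) (word K (sumlist qa [0, 1, 5]))) +
      length (filter (\<lambda>x. x \<noteq> 0) (word K (sumlist qa [0, 4, 5]))) +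
      length (filter (\<lambda>x. x \<noteq> 0) (word K (sumlist qb [0, 4, 5]))) \<le> 27 * length ws"
    using weight_word[of K "sumlist qa [0, 1, 5]"] weight_word[of K "sumlist qa [0, 4, 5]"]
      weight_word[of K "sumlist qb [0, 4, 5]"] by (simp add: qa_def qb_def)
  ultimately show ?thesis
    using tailbiting_valid_word[OF K]
    by (intro min_distance_turbo_code_3d_le[OF K L(1) \<open>L > 0\<close> L(3) Nc patch]) assumption+
qed

section \<open>The two divisibility cases\<close>

theorem theorem3:
  fixes K L Nc :: nat and lam :: real and f1 f2 g1 g2 :: nat
    and P :: "nat \<Rightarrow> nat" and E :: "bit list \<Rightarrow> bit list"
  assumes "K > 0" and "lam > 0"
    and "1 / lam = real L" and "4 dvd L" and "L dvd K"
    and "has_quadratic_inverse K f1 f2 g1 g2"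
    and "real Nc = 2 * lam * real K" and "is_patch Nc P E"
  shows "([2 * g2 = 0] (mod K) \<longrightarrow>
            min_distance (turbo_code_3d K lam (quad_poly K f1 f2) P E) \<le> 27) \<and>
         ([4 * g2 = 0] (mod K) \<longrightarrow>
            min_distance (turbo_code_3d K lam (quad_poly K f1 f2) P E) \<le> 54)"
proof -
  let ?G = "quad_int g1 g2"
  let ?d = "min_distance (turbo_code_3d K lam (quad_poly K f1 f2) P E)"
  note bound = min_distance_quad_le[OF assms(1,3-8)]
  have "is_qpp K g1 g2" "4 dvd K"
    using assms(4-6) dvd_trans by (auto simp: has_quadratic_inverse_def)
  note parity = qpp_coeff_parity[OF this]
  have G_add: "?G (b + d) = ?G b + ?G d + 2 * int g2 * (b * d)" for b d
    by (simp add: quad_int_def algebra_simps power2_eq_square)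
  have case1: "?d \<le> 27" if "[2 * g2 = 0] (mod K)"
  proof -
    have "int K dvd int (2 * g2)"
      using that by (simp only: cong_0_iff of_nat_dvd_iff)
    then have "[?G (b + d) = ?G b + ?G d] (mod int K)" for b d
      by (simp add: G_add cong_iff_dvd_diff)
    then have "[t = ?G (b + d)] (mod int K) \<longleftrightarrow> [t = ?G b + ?G d] (mod int K)" for t b d
      using cong_sym cong_trans by blast
    then have "?d \<le> enat (27 * length [0 :: int])"
      using parity_at_odd_neq_0[OF assms(1)] by (intro bound) (simp_all add: parity_at_def parity_at_sumlist[of _ _ "[0]"])
    then show ?thesis by (simp add: numeral_eq_enat)
  qed
  moreover have "?d \<le> 54" if "[4 * g2 = 0] (mod K)"
  proof (cases "[2 * g2 = 0] (mod K)")
    \<comment> \<open>With \<open>W\<close> congruent to 0 the doubled pattern would cancel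
      completely, so the single one is used.\<close>
    case True
    then show ?thesis using case1 order_trans[of ?d 27 54] by simp
  next
    case False
    define W where "W = 2 * int g2"
    have "int K dvd int (4 * g2)" "\<not> int K dvd int (2 * g2)"
      using that False by (simp_all only: cong_0_iff of_nat_dvd_iff not_False_eq_True)
    then have W: "int K dvd 2 * W" "\<not> int K dvd W" by (simp_all add: W_def)
    have W_even: "int K dvd W * x" if x: "even x" for x
    proof -
      obtain y where "x = 2 * y" using x by blast
      then show ?thesis using dvd_mult2[OF W(1), of y] by (simp only: ac_simps)
    qed
    have G_W: "[?G (x + W) = ?G x + W] (mod int K)" for x
    proof -
      \<comment> \<open>The cofactor of \<open>W\<close> is even because \<open>g1\<close> is odd
        and \<open>W\<close> is even, and even multiples of \<open>W\<close> vanish modulo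
        \<open>K\<close>.\<close>
      have "?G (x + W) - (?G x + W) = W * (int g1 - 1 + int g2 * W + W * x)"
        by (simp add: W_def quad_int_def algebra_simps power2_eq_square)
      moreover have "even (int g1 - 1 + int g2 * W + W * x)"
        using parity by (simp add: W_def)
      ultimately show ?thesis using W_even by (simp add: cong_iff_dvd_diff)
    qed
    \<comment> \<open>The mixed term \<open>2 g\<^sub>2 b d\<close> is congruent to 0 or to \<open>W\<close>, so it at most swaps the two positions.\<close>
    have shift: "parity_at K (map (\<lambda>w. ?G (b + d + w)) [0, W]) t = parity_at K (map ((+) (?G b + ?G d)) [0, W]) t"
      for b d t
    proof -
      let ?s = "?G b + ?G d"
      have swap: "([t = x] (mod int K)) \<longleftrightarrow> ([t = y] (mod int K))" if "int K dvd x - y" for x y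
        using that cong_iff_dvd_diff cong_sym cong_trans by metis
      have G_W': "int K dvd ?G (b + d + W) - (?G (b + d) + W)"
        using G_W[of "b + d"] by (simp add: cong_iff_dvd_diff)
      show ?thesis
      proof (cases "even (b * d)")
        case True
        then have "int K dvd ?G (b + d) - ?s"
          using W_even by (simp add: G_add W_def)
        moreover from this have
          "int K dvd (?G (b + d + W) - (?G (b + d) + W)) + (?G (b + d) - ?s)"
          using G_W' by (intro dvd_add)
        then have "int K dvd ?G (b + d + W) - (?s + W)" by (simp add: algebra_simps)
        ultimately show ?thesis
          using swap[of "?G (b + d)" ?s] swap[of "?G (b + d + W)" "?s + W"] by (simp add: parity_at_def)
      next
        case False
        have "?G (b + d) - (?s + W) = W * (b * d - 1)"
          by (simp add: G_add W_def algebra_simps)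
        then have 1: "int K dvd ?G (b + d) - (?s + W)"
          using W_even False by simp
        \<comment> \<open>\<open>W\<close> enters twice, from the mixed term and from the shift, and
          \<open>2 * W\<close> vanishes.\<close>
        have "int K dvd (?G (b + d + W) - (?G (b + d) + W)) + (?G (b + d) - (?s + W)) + 2 * W"
          using 1 G_W' W(1) by (intro dvd_add)
        then have "int K dvd ?G (b + d + W) - ?s" by (simp add: algebra_simps)
        with 1 show ?thesis
          using swap[of "?G (b + d)" "?s + W"] swap[of "?G (b + d + W)" ?s]
          by (simp add: parity_at_def add.commute)
      qed
    qed
    \<comment> \<open>Translation by \<open>W\<close> thus preserves residues modulo 4 and keeps the
      patch input zero.\<close>
    have "4 dvd W" using parity(2) by (auto simp: W_def elim!: evenE)
    then have "?d \<le> enat (27 * length [0, W])"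
      using shift parity_at_doubled_odd_neq_0[OF assms(1)] W by (intro bound) (auto simp: cong_0_iff)
    then show ?thesis by (simp add: numeral_eq_enat)
  qed
  ultimately show ?thesis by blast
qed

end
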